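(* Let $\mathcal{Y} \subseteq \mathbb{R}^n$ and let $F:\mathbb{R}^m \rightrightarrows \mathcal{Y}$ be a set-valued mapping with closed graph, i.e. such that $$\operatorname{gph} F = \{(\mathbf{x}, \mathbf{y}) \in \mathbb{R}^m \times \mathcal{Y} \mid \mathbf{y} \in F(\mathbf{x})\}$$ is a closed subset of $\mathbb{R}^m \times \mathbb{R}^n$, and suppose $F(\mathbf{x}) \neq \emptyset$ for all $\mathbf{x} \in \mathbb{R}^m$. Then there exists a continuous function $g:\mathbb{R}^m \times \mathbb{R}^n \rightarrow \mathbb{R}^n$ such that the solution mapping $$S:\mathbb{R}^m \rightrightarrows \mathcal{Y}, \quad S(\mathbf{x}) = \{ \mathbf{y} \in \mathbb{R}^n \mid g(\mathbf{x},\mathbf{y}) = 0 \}$$ satisfies $S(\mathbf{x}) \neq \emptyset$ for all $\mathbf{x} \in \mathbb{R}^m$ and $$F(\mathbf{x}) = S(\mathbf{x}) \quad \text{for all } \mathbf{x} \in \mathbb{R}^m.$$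
   Context: A set-valued mapping $F: A \rightrightarrows B$ assigns to each $x \in A$ a subset $F(x) \subseteq B$. *)

theory Defs
  imports "HOL-Analysis.Analysis"
begin

(* A set-valued mapping from A to B is a function into sets; only its values on A matter. *)
definition set_valued_map :: "'a set \<Rightarrow> 'b set \<Rightarrow> ('a \<Rightarrow> 'b set) \<Rightarrow> bool" where
  "set_valued_map A B F \<longleftrightarrow> (\<forall>x\<in>A. F x \<subseteq> B)"

definition gph :: "'a set \<Rightarrow> 'b set \<Rightarrow> ('a \<Rightarrow> 'b set) \<Rightarrow> ('a \<times> 'b) set" where
  "gph A B F = {(x, y) \<in> A \<times> B. y \<in> F x}"

definition solution_map :: "('a \<times> 'b \<Rightarrow> 'c::zero) \<Rightarrow> 'a \<Rightarrow> 'b set" where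
  "solution_map g x = {y. g (x, y) = 0}"

end

theory Submission
  imports Defs
begin

text \<open>
  A closed nonempty set is the zero set of the distance to it, and this distance is
  continuous. Applied to the graph of \<open>F\<close>, this gives a scalar equation for \<open>y \<in> F x\<close>;
  multiplying it by a fixed nonzero vector gives an equation in \<open>\<real>\<^sup>n\<close> with the same solutions.
\<close>

theorem theorem1:
  fixes Y :: "(real ^ 'n) set"
    and F :: "real ^ 'm \<Rightarrow> (real ^ 'n) set"
  assumes "set_valued_map UNIV Y F"
    and "closed (gph UNIV Y F)"
    and "\<forall>x. F x \<noteq> {}"
  shows "\<exists>g :: (real ^ 'm) \<times> (real ^ 'n) \<Rightarrow> real ^ 'n.
           continuous_on UNIV g \<and>
           set_valued_map UNIV Y (solution_map g) \<and>
           (\<forall>x. solution_map g x \<noteq> {}) \<and>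
           (\<forall>x. F x = solution_map g x)"
proof -
  let ?G = "gph UNIV Y F"
  define g :: "(real ^ 'm) \<times> (real ^ 'n) \<Rightarrow> real ^ 'n"
    where "g z = infdist z ?G *\<^sub>R 1" for z
  have mem: "(x, y) \<in> ?G \<longleftrightarrow> y \<in> F x" for x y
    using assms(1) by (auto simp: gph_def set_valued_map_def)
  \<comment> \<open>Needed because \<^const>\<open>infdist\<close> to the empty set is \<open>0\<close> everywhere.\<close>
  have "?G \<noteq> {}"
    using assms(3) mem by fastforce
  then have "g (x, y) = 0 \<longleftrightarrow> y \<in> F x" for x y
    using in_closed_iff_infdist_zero[OF assms(2)] mem by (simp add: g_def)
  then have eq: "solution_map g = F"
    by (auto simp: solution_map_def)
  have "continuous_on UNIV g"
    unfolding g_def by (intro continuous_intros)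
  with eq assms(1,3) show ?thesis
    by blast
qed

end
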